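(* Let $\alpha\in(0,1]$. Let $(\mathcal Q,d)$ be a separable and complete metric space and let $o\in\mathcal Q$ be an arbitrary fixed element. Let $Y$ be a random variable with values in $\mathcal Q$, and let $Y_1,Y_2,\dots$ be independent random variables with the same distribution as $Y$. Let $(\epsilon_n)_{n\in\mathbb N}\subseteq[0,\infty)$ with $\epsilon_n\to0$ as $n\to\infty$. Set $$M=\operatorname*{arg\,min}_{q\in\mathcal Q}\mathbb E[d(Y,q)^\alpha-d(Y,o)^\alpha],\qquad M_n=\epsilon_n\text{-}\operatorname*{arg\,min}_{q\in\mathcal Q}\frac1n\sum_{i=1}^n\bigl(d(Y_i,q)^\alpha-d(Y_i,o)^\alpha\bigr).$$ (i) Then $\operatorname*{lim\,\overline{sup}}_{n\to\infty}M_n\subseteq M$ almost surely. (ii) Additionally, assume that almost surely the following is true: there is $N_0\in\mathbb N$ such that every closed and bounded subset (closed in $\mathcal Q$) of $\bigcup_{n\ge N_0}M_n$ is compact. Then $d_\subseteq(M_n,M)\to0$ almost surely as $n\to\infty$.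
   Context: All random variables are defined on a common probability space $(\Omega,\Sigma,\mathbb P)$; $\mathcal Q$ carries its Borel $\sigma$-algebra. For $f\colon\mathcal Q\to\mathbb R$ and $\epsilon\ge0$: $\operatorname{arg\,min} f=\{q\in\mathcal Q: f(q)=\inf_{\mathcal Q} f\}$ and $\epsilon\text{-}\operatorname{arg\,min} f=\{q\in\mathcal Q: f(q)\le\epsilon+\inf_{\mathcal Q} f\}$ (empty if $\inf_{\mathcal Q} f=-\infty$). The outer limit of a sequence of sets $B_n\subseteq\mathcal Q$ is $\operatorname*{lim\,\overline{sup}}_{n\to\infty}B_n:=\bigcap_{n\in\mathbb N}\overline{\bigcup_{k\ge n}B_k}$, where the bar denotes topological closure in $\mathcal Q$. The one-sided Hausdorff distance between $B,B'\subseteq\mathcal Q$ is $d_\subseteq(B,B'):=\sup_{x\in B}\inf_{x'\in B'}d(x,x')\in[0,\infty]$, with $\sup\emptyset=0$ and $\inf\emptyset=\infty$. "Almost surely" means outside a set contained in a $\mathbb P$-null set. *)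

theory Defs
  imports "HOL-Probability.Probability"
begin

text \<open>The infimum is taken in the extended reals. The real-valued \<open>Inf\<close> is
  an arbitrary value on sets that are not bounded below; here both sets are empty for such
  an \<open>f\<close>.\<close>

definition argmin_set :: "('q \<Rightarrow> real) \<Rightarrow> 'q set" where
  "argmin_set f = {q. ereal (f q) = (INF p. ereal (f p))}"

definition eps_argmin_set :: "real \<Rightarrow> ('q \<Rightarrow> real) \<Rightarrow> 'q set" where
  "eps_argmin_set \<epsilon> f = {q. ereal (f q) \<le> ereal \<epsilon> + (INF p. ereal (f p))}"

text \<open>The sets \<open>\<Union>k\<in>{n..}. B k\<close> decrease in \<open>n\<close>, so the member \<open>B 0\<close> of the
  sequence does not affect the outer limit.\<close>

definition outer_limit :: "(nat \<Rightarrow> 'q::topological_space set) \<Rightarrow> 'q set" where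
  "outer_limit B = (\<Inter>n. closure (\<Union>k\<in>{n..}. B k))"

text \<open>In \<open>ennreal\<close>, the supremum of the empty set is \<open>0\<close> and the infimum of the empty
  set is \<open>\<infinity>\<close>.\<close>

definition one_sided_hausdorff :: "'q::metric_space set \<Rightarrow> 'q set \<Rightarrow> ennreal" where
  "one_sided_hausdorff B B' = (SUP x\<in>B. INF x'\<in>B'. ennreal (dist x x'))"

end

theory Submission
  imports Defs
begin

text \<open>
  Write \<open>c y q = dist y q powr \<alpha> - dist y q0 powr \<alpha>\<close>, let \<open>F q\<close> be the expectation of \<open>c Y q\<close> and
  \<open>f n q\<close> its empirical counterpart. As \<open>\<alpha> \<le> 1\<close>, the power \<open>dist powr \<alpha>\<close> is itself a metric
  (\<open>abs_dist_powr_diff_le\<close>). So \<open>\<bar>c y q\<bar> \<le> dist q q0 powr \<alpha>\<close>, which makes \<open>F\<close> finite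
  however heavy the tails of \<open>Y\<close> are, and \<open>F\<close> and all \<open>f n\<close> share the modulus of continuity
  \<open>dist p q powr \<alpha>\<close>.

  For the inclusion of the outer limit, a strong law for bounded variables
  (\<open>bounded_iid_strong_law\<close>) gives \<open>f n q \<longlonglongrightarrow> F q\<close> almost surely for each \<open>q\<close>, hence almost surely
  for all \<open>q\<close> in a countable dense set, hence by equicontinuity for all \<open>q\<close>. The rest is
  deterministic: limits of approximate minimizers of equicontinuous functions minimize the
  pointwise limit (\<open>outer_limit_eps_argmin_subset_argmin\<close>).

  For the Hausdorff distance, points of \<open>Mn n\<close> that stay away from \<open>M\<close> along a subsequence must be
  shown to have a cluster point, because that point would lie in the outer limit and so in \<open>M\<close>
  (\<open>one_sided_hausdorff_tendsto_0\<close>). The compactness hypothesis speaks of closed bounded sets, so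
  what is missing is boundedness. It comes from coercivity: some ball around \<open>q0\<close> has probability
  above \<open>3 / 4\<close>, so by the strong law it eventually contains at least three quarters of the sample,
  and then \<open>f n\<close> grows at least like \<open>dist q q0 powr \<alpha> / 2\<close>, while \<open>f n q0 = 0\<close>
  (\<open>eps_argmin_empirical_bound\<close>).
\<close>

section \<open>Powers of a metric\<close>

text \<open>For \<open>t \<in> [0, 1]\<close> and \<open>\<alpha> \<le> 1\<close> one has \<open>t \<le> t powr \<alpha>\<close>. The fractions
  \<open>a / (a + b)\<close> and \<open>b / (a + b)\<close> add up to \<open>1\<close>, so their powers add up to at least \<open>1\<close>.\<close>

lemma powr_add_le_add_powr:
  fixes a b \<alpha> :: real
  assumes "0 \<le> a" "0 \<le> b" "0 < \<alpha>" "\<alpha> \<le> 1"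
  shows "(a + b) powr \<alpha> \<le> a powr \<alpha> + b powr \<alpha>"
proof (cases "a + b = 0")
  case True
  then show ?thesis using assms by simp
next
  case False
  then have pos: "a + b > 0" using assms by linarith
  have le: "t \<le> t powr \<alpha>" if "0 \<le> t" "t \<le> 1" for t :: real
    using powr_mono'[of \<alpha> 1 t] that assms by (cases "t = 0") auto
  have "1 = a / (a + b) + b / (a + b)"
    using pos by (simp add: add_divide_distrib[symmetric])
  also have "\<dots> \<le> (a / (a + b)) powr \<alpha> + (b / (a + b)) powr \<alpha>"
    using assms pos by (intro add_mono le) auto
  also have "\<dots> = (a powr \<alpha> + b powr \<alpha>) / (a + b) powr \<alpha>"
    using assms pos by (simp add: powr_divide add_divide_distrib)
  finally show ?thesis
    using pos by (simp add: le_divide_eq)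
qed

text \<open>By subadditivity of the power, \<open>dist powr \<alpha>\<close> is again a metric, and this is its reverse
  triangle inequality. It makes every integrand of the Frechet functional bounded in \<open>y\<close>,
  whatever the tails of its distribution, and gives all objective functions the same modulus
  of continuity.\<close>

lemma abs_dist_powr_diff_le:
  fixes y p q :: "'q::metric_space"
  assumes "0 < \<alpha>" "\<alpha> \<le> 1"
  shows "\<bar>dist y p powr \<alpha> - dist y q powr \<alpha>\<bar> \<le> dist p q powr \<alpha>"
proof -
  have "dist y p powr \<alpha> \<le> dist y q powr \<alpha> + dist p q powr \<alpha>" for p q :: 'q
  proof -
    have "dist y p powr \<alpha> \<le> (dist y q + dist p q) powr \<alpha>"
      using assms dist_triangle[of y p q] by (intro powr_mono2) (auto simp: dist_commute)
    also have "\<dots> \<le> dist y q powr \<alpha> + dist p q powr \<alpha>"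
      using assms by (intro powr_add_le_add_powr) auto
    finally show ?thesis .
  qed
  from this[of p q] this[of q p] show ?thesis by (simp add: dist_commute)
qed

section \<open>A strong law of large numbers for bounded variables\<close>

text \<open>For bounded variables the strong law needs no truncation: by Hoeffding's inequality the
  probability of a deviation of size \<open>e\<close> decays geometrically in \<open>n\<close>, so by Borel-Cantelli
  almost surely only finitely many such deviations occur. Letting \<open>e\<close> run through the numbers
  \<open>1 / (m + 1)\<close> gives convergence.\<close>

lemma (in prob_space) bounded_iid_strong_law:
  fixes X :: "nat \<Rightarrow> 'a \<Rightarrow> real"
  assumes indep: "indep_vars (\<lambda>_. borel) X {1..}"
    and distr: "\<And>i. i \<ge> 1 \<Longrightarrow> distr M borel (X i) = distr M borel Z"
    and Z: "random_variable borel Z"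
    and bound: "AE \<omega> in M. \<bar>Z \<omega>\<bar> \<le> C"
  shows "AE \<omega> in M. (\<lambda>n. (\<Sum>i=1..n. X i \<omega>) / n) \<longlonglongrightarrow> expectation Z"
proof -
  have X: "random_variable borel (X i)" if "i \<ge> 1" for i
    using indep that unfolding indep_vars_def by auto
  define A where "A e n = {\<omega> \<in> space M. \<bar>(\<Sum>i=1..n. X i \<omega>) / n - expectation Z\<bar> \<ge> e}"
    for e :: real and n :: nat
  have A: "A e n \<in> sets M" for e n
    unfolding A_def using X by measurable
  \<comment> \<open>Hoeffding's inequality needs a nondegenerate interval, also if \<open>C = 0\<close>.\<close>
  define K where "K = \<bar>C\<bar> + 1"
  have dev: "AE \<omega> in M. eventually (\<lambda>n. \<bar>(\<Sum>i=1..n. X i \<omega>) / n - expectation Z\<bar> < e) sequentially"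
    if "e > 0" for e
  proof -
    define r where "r = exp (- 2 * e\<^sup>2 / (2 * K)\<^sup>2)"
    have r: "0 < r" "r < 1" using that by (auto simp: r_def K_def)
    have le: "prob (A e n) \<le> 2 * r ^ n" if "n \<ge> 1" for n
    proof -
      interpret H: Hoeffding_ineq_iid M "{1..n}" X Z "-K" K "expectation Z"
      proof unfold_locales
        show "indep_vars (\<lambda>_. borel) X {1..n}"
          using indep by (rule indep_vars_subset) auto
        show "AE x in M. Z x \<in> {- K..K}"
          using bound by eventually_elim (auto simp: K_def)
      qed (use distr Z in auto)
      have "prob (A e n) \<le> 2 * exp (- 2 * n * e\<^sup>2 / (2 * K)\<^sup>2)"
        using H.Hoeffding_ineq_abs_ge'[of e] \<open>e > 0\<close> \<open>n \<ge> 1\<close> by (simp add: A_def K_def)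
      also have "exp (- 2 * n * e\<^sup>2 / (2 * K)\<^sup>2) = r ^ n"
        by (simp add: r_def exp_of_nat_mult[symmetric])
      finally show ?thesis .
    qed
    have "summable (\<lambda>n. prob (A e n))"
    proof (rule summable_comparison_test')
      show "summable (\<lambda>n. 2 * r ^ n)"
        using r by (intro summable_mult summable_geometric) auto
      show "norm (prob (A e n)) \<le> 2 * r ^ n" if "n \<ge> 1" for n
        using le[OF that] by simp
    qed
    then have "AE \<omega> in M. eventually (\<lambda>n. \<omega> \<in> space M - A e n) sequentially"
      using A by (intro borel_cantelli_AE1) (auto simp: emeasure_eq_measure)
    then show ?thesis
      by eventually_elim (auto elim!: eventually_mono simp: A_def)
  qed
  have "AE \<omega> in M. \<forall>m. eventually (\<lambda>n. \<bar>(\<Sum>i=1..n. X i \<omega>) / n - expectation Z\<bar> < inverse (Suc m)) sequentially"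
    by (subst AE_all_countable) (intro allI dev, simp)
  then show ?thesis
  proof eventually_elim
    case (elim \<omega>)
    show ?case
    proof (rule tendstoI)
      fix e :: real assume "e > 0"
      then obtain m where "inverse (real (Suc m)) < e" using reals_Archimedean by blast
      with elim[rule_format, of m]
      show "eventually (\<lambda>n. dist ((\<Sum>i=1..n. X i \<omega>) / n) (expectation Z) < e) sequentially"
        by (auto elim!: eventually_mono simp: dist_real_def)
    qed
  qed
qed

lemma (in prob_space) bounded_function_of_iid_strong_law:
  fixes Ys :: "nat \<Rightarrow> 'a \<Rightarrow> 'q::topological_space" and h :: "'q \<Rightarrow> real"
  assumes indep: "indep_vars (\<lambda>_. borel) Ys {1..}"
    and distr: "\<And>i. i \<ge> 1 \<Longrightarrow> distr M borel (Ys i) = distr M borel Y"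
    and Y: "random_variable borel Y"
    and h: "h \<in> borel_measurable borel" and bound: "\<And>y. \<bar>h y\<bar> \<le> C"
  shows "AE \<omega> in M. (\<lambda>n. (\<Sum>i=1..n. h (Ys i \<omega>)) / n) \<longlonglongrightarrow> expectation (\<lambda>\<omega>. h (Y \<omega>))"
proof (rule bounded_iid_strong_law)
  show "indep_vars (\<lambda>_. borel) (\<lambda>i \<omega>. h (Ys i \<omega>)) {1..}"
    using indep h by (rule indep_vars_compose2)
  fix i :: nat assume i: "i \<ge> 1"
  have Yi: "random_variable borel (Ys i)"
    using indep i unfolding indep_vars_def by auto
  have "distr M borel (\<lambda>\<omega>. h (Ys i \<omega>)) = distr (distr M borel (Ys i)) borel h"
    using Yi h by (simp add: distr_distr comp_def)
  also have "\<dots> = distr (distr M borel Y) borel h"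
    by (simp only: distr[OF i])
  also have "\<dots> = distr M borel (\<lambda>\<omega>. h (Y \<omega>))"
    using Y h by (simp add: distr_distr comp_def)
  finally show "distr M borel (\<lambda>\<omega>. h (Ys i \<omega>)) = distr M borel (\<lambda>\<omega>. h (Y \<omega>))" .
qed (use Y h bound in auto)

lemma (in prob_space) exists_cball_prob_gt:
  fixes Y :: "'a \<Rightarrow> 'q::metric_space"
  assumes Y: "random_variable borel Y" and "c < 1"
  shows "\<exists>R\<ge>0. c < prob {\<omega> \<in> space M. Y \<omega> \<in> cball q0 R}"
proof -
  define B where "B n = {\<omega> \<in> space M. Y \<omega> \<in> cball q0 (real n)}" for n
  have B: "B n \<in> sets M" for n
    unfolding B_def using measurable_sets[OF Y, of "cball q0 (real n)"]
    by (simp add: vimage_def Int_def conj_commute)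
  have "(\<lambda>n. prob (B n)) \<longlonglongrightarrow> prob (\<Union>n. B n)"
    using B by (intro finite_Lim_measure_incseq) (force simp: B_def incseq_def)+
  also have "(\<Union>n. B n) = space M"
    using real_arch_simple by (auto simp: B_def)
  finally have "eventually (\<lambda>n. c < prob (B n)) sequentially"
    using \<open>c < 1\<close> by (intro order_tendstoD(1)) (auto simp: prob_space)
  then obtain n where "c < prob (B n)" by (auto simp: eventually_sequentially)
  then show ?thesis unfolding B_def by (intro exI[of _ "real n"]) auto
qed

section \<open>Limits of approximate minimizers\<close>

lemma eps_argmin_setD:
  assumes "q \<in> eps_argmin_set e f"
  shows "f q \<le> e + f p"
proof -
  have "ereal (f q) \<le> ereal e + (INF p. ereal (f p))"
    using assms by (simp add: eps_argmin_set_def)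
  also have "\<dots> \<le> ereal e + ereal (f p)"
    by (intro add_left_mono INF_lower) simp
  finally show ?thesis by simp
qed

lemma argmin_setI:
  assumes "\<And>p. f q \<le> f p"
  shows "q \<in> argmin_set f"
  unfolding argmin_set_def using assms by (auto intro!: antisym INF_greatest INF_lower)

text \<open>Almost sure convergence at each point gives almost sure convergence at countably many points
  at once, but the null sets of uncountably many points may add up. Equicontinuity transfers the convergence from a countable dense set to
  all points, outside the same null set.\<close>

lemma tendsto_from_dense_if_equicontinuous:
  fixes f :: "nat \<Rightarrow> 'q::metric_space \<Rightarrow> real"
  assumes dense: "\<And>X. open X \<Longrightarrow> X \<noteq> {} \<Longrightarrow> \<exists>d\<in>D. d \<in> X"
    and conv: "\<And>q. q \<in> D \<Longrightarrow> (\<lambda>n. f n q) \<longlonglongrightarrow> F q"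
    and equi: "\<And>e. e > 0 \<Longrightarrow> \<exists>d>0. \<forall>n p q. dist p q < d \<longrightarrow> \<bar>f n p - f n q\<bar> < e"
    and cont: "\<And>q. isCont F q"
  shows "(\<lambda>n. f n q) \<longlonglongrightarrow> F q"
proof (rule tendstoI)
  fix e :: real assume "e > 0"
  then have e3: "e / 3 > 0" by simp
  obtain d1 where d1: "d1 > 0" "\<And>n p q. dist p q < d1 \<Longrightarrow> \<bar>f n p - f n q\<bar> < e / 3"
    using equi[OF e3] by blast
  obtain d2 where d2: "d2 > 0" "\<And>p. dist p q < d2 \<Longrightarrow> dist (F p) (F q) < e / 3"
    using cont[of q] e3 unfolding continuous_at_eps_delta by blast
  obtain p where p: "p \<in> D" "p \<in> ball q (min d1 d2)"
    using dense[of "ball q (min d1 d2)"] d1(1) d2(1)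
    by (metis centre_in_ball empty_iff min_less_iff_conj open_ball)
  have "eventually (\<lambda>n. dist (f n p) (F p) < e / 3) sequentially"
    using conv[OF p(1)] e3 by (rule tendstoD)
  then show "eventually (\<lambda>n. dist (f n q) (F q) < e) sequentially"
  proof eventually_elim
    case (elim n)
    have "\<bar>f n p - f n q\<bar> < e / 3" "dist (F p) (F q) < e / 3"
      using d1(2)[of p q] d2(2)[of p] p(2) by (auto simp: dist_commute)
    with elim show ?case unfolding dist_real_def by linarith
  qed
qed

text \<open>A point \<open>q\<close> of the outer limit has, for arbitrarily large \<open>k\<close>, an approximate minimizer \<open>x\<close> of
  \<open>f k\<close> nearby. Equicontinuity replaces \<open>f k x\<close> by \<open>f k q\<close> at small cost, so in the limit no
  competitor \<open>p\<close> beats \<open>q\<close>.\<close>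

lemma outer_limit_eps_argmin_subset_argmin:
  fixes f :: "nat \<Rightarrow> 'q::metric_space \<Rightarrow> real"
  assumes conv: "\<And>q. (\<lambda>n. f n q) \<longlonglongrightarrow> F q"
    and equi: "\<And>e. e > 0 \<Longrightarrow> \<exists>d>0. \<forall>n p q. dist p q < d \<longrightarrow> \<bar>f n p - f n q\<bar> < e"
    and \<epsilon>: "\<epsilon> \<longlonglongrightarrow> 0"
  shows "outer_limit (\<lambda>n. eps_argmin_set (\<epsilon> n) (f n)) \<subseteq> argmin_set F"
proof
  fix q assume q: "q \<in> outer_limit (\<lambda>n. eps_argmin_set (\<epsilon> n) (f n))"
  show "q \<in> argmin_set F"
  proof (rule argmin_setI, rule field_le_epsilon)
    fix p and e :: real assume "e > 0"
    then have e4: "e / 4 > 0" by simp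
    obtain d where d: "d > 0" "\<And>n p q. dist p q < d \<Longrightarrow> \<bar>f n p - f n q\<bar> < e / 4"
      using equi[OF e4] by blast
    have "eventually (\<lambda>n. dist (f n p) (F p) < e / 4 \<and> dist (f n q) (F q) < e / 4 \<and> dist (\<epsilon> n) 0 < e / 4) sequentially"
      by (intro eventually_conj tendstoD conv \<epsilon> e4)
    then obtain N where N: "\<And>n. n \<ge> N \<Longrightarrow> dist (f n p) (F p) < e / 4 \<and> dist (f n q) (F q) < e / 4 \<and> dist (\<epsilon> n) 0 < e / 4"
      by (auto simp: eventually_sequentially)
    from q have "q \<in> closure (\<Union>k\<in>{N..}. eps_argmin_set (\<epsilon> k) (f k))"
      by (auto simp: outer_limit_def)
    then obtain k x where k: "k \<ge> N" and x: "x \<in> eps_argmin_set (\<epsilon> k) (f k)" and "dist x q < d"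
      using d(1) unfolding closure_approachable by auto
    then have "\<bar>f k x - f k q\<bar> < e / 4" using d(2) by blast
    with N[OF k] eps_argmin_setD[OF x, of p] show "F q \<le> F p + e"
      unfolding dist_real_def by linarith
  qed
qed

section \<open>From outer limits to the Hausdorff distance\<close>

text \<open>In the application compactness is known for closed subsets of a given set, and the closure of
  the values may leave that set. The range itself is enough: if there were no cluster
  point, then every point in the closure of the range would already lie in the closure of finitely
  many values, hence be a value itself. So the range is closed, thus compact, and a convergent
  subsequence contradicts the absence of cluster points.\<close>

lemma exists_cluster_point:
  fixes x :: "nat \<Rightarrow> 'q::metric_space"
  assumes "closed (range x) \<Longrightarrow> compact (range x)"
  shows "\<exists>l. \<forall>n. l \<in> closure (x ` {n..})"
proof (rule ccontr)
  assume no: "\<nexists>l. \<forall>n. l \<in> closure (x ` {n..})"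
  have "l \<in> range x" if "l \<in> closure (range x)" for l
  proof -
    obtain n where n: "l \<notin> closure (x ` {n..})" using no by blast
    have "range x = x ` {..<n} \<union> x ` {n..}"
      by (metis Compl_lessThan Compl_partition image_Un)
    then have "l \<in> closure (x ` {..<n})"
      using that n by (simp add: closure_Un)
    then show ?thesis
      using finite_imp_closed[of "x ` {..<n}"] by auto
  qed
  then have "closed (range x)"
    using closure_subset_eq by blast
  then have "seq_compact (range x)"
    using assms compact_imp_seq_compact by blast
  then obtain l r where r: "strict_mono r" "(x \<circ> r) \<longlonglongrightarrow> l"
    unfolding seq_compact_def by blast
  have "l \<in> closure (x ` {n..})" for n
  proof (rule closed_sequentially)
    show "closed (closure (x ` {n..}))" by simp
    show "(\<lambda>k. (x \<circ> r) (k + n)) \<longlonglongrightarrow> l" using r(2) by (rule LIMSEQ_ignore_initial_segment)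
    fix k
    have "n \<le> r (k + n)" using seq_suble[OF r(1), of "k + n"] by linarith
    then show "(x \<circ> r) (k + n) \<in> closure (x ` {n..})"
      by (intro subsetD[OF closure_subset]) auto
  qed
  with no show False by blast
qed

text \<open>If the distance does not tend to \<open>0\<close>, there are points \<open>x m\<close> in sets \<open>B (r m)\<close> with
  \<open>r m \<ge> m\<close> that stay away from \<open>M\<close>. They have a cluster point, which lies in the outer limit
  and hence in \<open>M\<close>: a contradiction. In the case \<open>M = {}\<close> all points are infinitely far
  from \<open>M\<close>, and the argument shows that the sets \<open>B n\<close> are eventually empty.\<close>

lemma one_sided_hausdorff_tendsto_0:
  fixes B :: "nat \<Rightarrow> 'q::metric_space set"
  assumes outer: "outer_limit B \<subseteq> M"
    and bounded: "bounded (\<Union>n\<in>{N..}. B n)"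
    and compact: "\<And>K. K \<subseteq> (\<Union>n\<in>{N..}. B n) \<Longrightarrow> closed K \<Longrightarrow> bounded K \<Longrightarrow> compact K"
  shows "(\<lambda>n. one_sided_hausdorff (B n) M) \<longlonglongrightarrow> 0"
proof (rule order_tendstoI)
  fix a :: ennreal assume "0 < a"
  then obtain c where c: "0 < c" "c < a" using dense by blast
  have "eventually (\<lambda>n. one_sided_hausdorff (B n) M \<le> c) sequentially"
  proof (rule ccontr)
    assume "\<not> ?thesis"
    then have "\<exists>n\<ge>m. c < one_sided_hausdorff (B n) M" for m
      by (auto simp: eventually_sequentially not_le)
    then have "\<exists>n\<ge>m. \<exists>x\<in>B n. c < (INF x'\<in>M. ennreal (dist x x'))" for m
      by (simp add: one_sided_hausdorff_def less_SUP_iff)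
    then obtain r x where r: "\<And>m. r m \<ge> m" and x: "\<And>m. x m \<in> B (r m)"
      and far: "\<And>m. c < (INF x'\<in>M. ennreal (dist (x m) x'))"
      by metis
    \<comment> \<open>The shift by \<open>N\<close> keeps all points in the union to which boundedness and compactness apply.\<close>
    define y where "y m = x (m + N)" for m
    have yB: "y m \<in> B (r (m + N))" "r (m + N) \<ge> m + N" for m
      using r x by (auto simp: y_def)
    have sub: "range y \<subseteq> (\<Union>n\<in>{N..}. B n)"
    proof clarsimp
      fix m
      have "r (m + N) \<ge> N" using yB(2)[of m] by linarith
      with yB(1)[of m] show "\<exists>k\<in>{N..}. y m \<in> B k" by blast
    qed
    obtain l where l: "\<And>n. l \<in> closure (y ` {n..})"
      using exists_cluster_point[of y] compact[OF sub] bounded_subset[OF bounded sub] by blast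
    have "l \<in> closure (\<Union>k\<in>{n..}. B k)" for n
    proof (rule subsetD[OF closure_mono l])
      show "y ` {n..} \<subseteq> (\<Union>k\<in>{n..}. B k)"
      proof clarsimp
        fix m assume "n \<le> m"
        with yB(2)[of m] have "n \<le> r (m + N)" by linarith
        with yB(1)[of m] show "\<exists>k\<in>{n..}. y m \<in> B k" by blast
      qed
    qed
    then have "l \<in> M" using outer by (auto simp: outer_limit_def)
    obtain \<delta> where \<delta>: "c = ennreal \<delta>" "0 < \<delta>"
      using c by (cases c) auto
    obtain m where "dist (y m) l < \<delta>"
      using l[of 0] \<delta>(2) unfolding closure_approachable by auto
    then have "ennreal (dist (y m) l) < c"
      using \<delta> by (simp add: ennreal_lessI)
    moreover have "(INF x'\<in>M. ennreal (dist (y m) x')) \<le> ennreal (dist (y m) l)"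
      using \<open>l \<in> M\<close> by (rule INF_lower)
    ultimately show False
      using far[of "m + N"] by (simp add: y_def)
  qed
  then show "eventually (\<lambda>n. one_sided_hausdorff (B n) M < a) sequentially"
    using c(2) by (auto elim!: eventually_mono)
qed simp

section \<open>Boundedness of empirical minimizers\<close>

text \<open>Seen from a point \<open>y\<close> in the ball of radius \<open>R\<close> around \<open>q0\<close>, moving from
  \<open>q0\<close> to a remote \<open>q\<close> costs at least \<open>dist q q0 powr \<alpha> - 2 * R powr \<alpha>\<close>; seen from any other
  point it gains at most \<open>dist q q0 powr \<alpha>\<close>. The indicator merges the two cases into one bound that can be summed over a sample.\<close>

lemma dist_powr_diff_ge:
  fixes y q q0 :: "'q::metric_space"
  assumes "0 < \<alpha>" "\<alpha> \<le> 1"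
  shows "2 * (dist q q0 powr \<alpha> - R powr \<alpha>) * indicator (cball q0 R) y - dist q q0 powr \<alpha>
    \<le> dist y q powr \<alpha> - dist y q0 powr \<alpha>"
proof (cases "y \<in> cball q0 R")
  case True
  then have "dist y q0 powr \<alpha> \<le> R powr \<alpha>"
    using assms by (intro powr_mono2) (auto simp: dist_commute)
  moreover have "dist q q0 powr \<alpha> \<le> dist y q powr \<alpha> + dist y q0 powr \<alpha>"
    using abs_dist_powr_diff_le[OF assms, of q q0 y] by (simp add: dist_commute)
  ultimately show ?thesis using True by (simp add: algebra_simps)
next
  case False
  then show ?thesis
    using abs_dist_powr_diff_le[OF assms, of y q q0] by simp
qed

text \<open>If a clear majority of the sample lies in one ball, the costs of moving far away from it
  outweigh the gains, by at least half of \<open>dist q q0 powr \<alpha>\<close> up to a multiple of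
  \<open>R powr \<alpha>\<close>. An approximate minimizer has value at most \<open>e\<close>, since the objective vanishes at
  \<open>q0\<close>, and so it cannot be remote. The fraction \<open>3 / 4\<close> could be any constant above \<open>1 / 2\<close>,
  with other constants in the bound.\<close>

lemma eps_argmin_empirical_bound:
  fixes y :: "nat \<Rightarrow> 'q::metric_space"
  assumes \<alpha>: "0 < \<alpha>" "\<alpha> \<le> 1" and "n \<ge> 1" "0 \<le> e"
    and mass: "(\<Sum>i=1..n. indicator (cball q0 R) (y i)) / n \<ge> (3 / 4 :: real)"
    and q: "q \<in> eps_argmin_set e
      (\<lambda>q. 1 / real n * (\<Sum>i=1..n. dist (y i) q powr \<alpha> - dist (y i) q0 powr \<alpha>))"
  shows "dist q q0 powr \<alpha> \<le> 2 * e + 3 * R powr \<alpha>"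
proof (cases "dist q q0 powr \<alpha> \<le> R powr \<alpha>")
  case True
  then show ?thesis using \<open>0 \<le> e\<close> by (smt (verit) powr_ge_zero)
next
  case False
  define D where "D = dist q q0 powr \<alpha>"
  define p :: real where "p = (\<Sum>i=1..n. indicator (cball q0 R) (y i)) / n"
  have "2 * (D - R powr \<alpha>) * (\<Sum>i=1..n. indicator (cball q0 R) (y i)) - n * D
      = (\<Sum>i=1..n. 2 * (D - R powr \<alpha>) * indicator (cball q0 R) (y i) - D)"
    by (simp add: sum_subtractf sum_distrib_left)
  also have "\<dots> \<le> (\<Sum>i=1..n. dist (y i) q powr \<alpha> - dist (y i) q0 powr \<alpha>)"
    unfolding D_def using \<alpha> by (intro sum_mono dist_powr_diff_ge)
  also have "\<dots> \<le> n * e"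
    using eps_argmin_setD[OF q, of q0] \<open>n \<ge> 1\<close> by (simp add: field_simps)
  finally have "2 * (D - R powr \<alpha>) * p - D \<le> e"
    using \<open>n \<ge> 1\<close> by (simp add: p_def field_simps)
  moreover have "2 * (D - R powr \<alpha>) * (3 / 4) \<le> 2 * (D - R powr \<alpha>) * p"
    using False mass by (intro mult_left_mono) (auto simp: D_def p_def)
  ultimately have "2 * (D - R powr \<alpha>) * (3 / 4) - D \<le> e" by linarith
  then show ?thesis unfolding D_def[symmetric] by (simp add: algebra_simps)
qed

lemma dist_powr_le_imp_bounded:
  fixes S :: "'q::metric_space set"
  assumes "0 < \<alpha>" "\<And>q. q \<in> S \<Longrightarrow> dist q q0 powr \<alpha> \<le> C"
  shows "bounded S"
proof (rule bounded_subset[OF bounded_cball])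
  show "S \<subseteq> cball q0 (C powr (1 / \<alpha>))"
  proof
    fix q assume "q \<in> S"
    have "dist q q0 = (dist q q0 powr \<alpha>) powr (1 / \<alpha>)"
      using assms(1) by (simp add: powr_powr)
    also have "\<dots> \<le> C powr (1 / \<alpha>)"
      using assms(1) assms(2)[OF \<open>q \<in> S\<close>] by (intro powr_mono2) auto
    finally show "q \<in> cball q0 (C powr (1 / \<alpha>))" by (simp add: dist_commute)
  qed
qed

section \<open>Strong consistency of approximate Frechet means\<close>

theorem corollary5p2:
  fixes P :: "'w measure"
    and \<alpha> :: real
    and q0 :: "'q::polish_space"
    and Y :: "'w \<Rightarrow> 'q"
    and Ys :: "nat \<Rightarrow> 'w \<Rightarrow> 'q"
    and \<epsilon> :: "nat \<Rightarrow> real"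
    and M :: "'q set"
    and Mn :: "nat \<Rightarrow> 'w \<Rightarrow> 'q set"
  assumes "prob_space P"
    and "0 < \<alpha>" and "\<alpha> \<le> 1"
    and "Y \<in> measurable P borel"
    and "prob_space.indep_vars P (\<lambda>_. borel) Ys {1..}"
    and "\<And>i. i \<ge> 1 \<Longrightarrow> distr P borel (Ys i) = distr P borel Y"
    and "\<And>n. n \<ge> 1 \<Longrightarrow> \<epsilon> n \<ge> 0"
    and "\<epsilon> \<longlonglongrightarrow> 0"
  defines "M \<equiv> argmin_set (\<lambda>q. \<integral>\<omega>. (dist (Y \<omega>) q powr \<alpha> - dist (Y \<omega>) q0 powr \<alpha>) \<partial>P)"
    and "Mn \<equiv> \<lambda>n \<omega>. eps_argmin_set (\<epsilon> n)
           (\<lambda>q. 1 / real n * (\<Sum>i=1..n. dist (Ys i \<omega>) q powr \<alpha> - dist (Ys i \<omega>) q0 powr \<alpha>))"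
  shows "(AE \<omega> in P. outer_limit (\<lambda>n. Mn n \<omega>) \<subseteq> M) \<and>
    ((AE \<omega> in P. \<exists>N0\<ge>1. \<forall>K. K \<subseteq> (\<Union>n\<in>{N0..}. Mn n \<omega>) \<and> closed K \<and> bounded K \<longrightarrow> compact K)
      \<longrightarrow> (AE \<omega> in P. (\<lambda>n. one_sided_hausdorff (Mn n \<omega>) M) \<longlonglongrightarrow> 0))"
proof -
  interpret prob_space P by fact
  note \<alpha> = \<open>0 < \<alpha>\<close> \<open>\<alpha> \<le> 1\<close>
  note Y [measurable] = \<open>Y \<in> measurable P borel\<close>
  define c where "c y q = dist y q powr \<alpha> - dist y q0 powr \<alpha>" for y q :: 'q
  define F where "F q = expectation (\<lambda>\<omega>. c (Y \<omega>) q)" for q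
  define f where "f \<omega> n q = 1 / real n * (\<Sum>i=1..n. c (Ys i \<omega>) q)" for \<omega> n q
  have M: "M = argmin_set F" and Mn: "Mn = (\<lambda>n \<omega>. eps_argmin_set (\<epsilon> n) (f \<omega> n))"
    by (simp_all add: M_def Mn_def F_def[abs_def] f_def[abs_def] c_def)
  have c_bound: "\<bar>c y q\<bar> \<le> dist q q0 powr \<alpha>" for y q
    unfolding c_def using \<alpha> by (rule abs_dist_powr_diff_le)
  have c_diff: "\<bar>c y p - c y q\<bar> \<le> dist p q powr \<alpha>" for y p q
    using abs_dist_powr_diff_le[OF \<alpha>, of y p q] by (simp add: c_def)
  have c_meas [measurable]: "(\<lambda>y. c y q) \<in> borel_measurable borel" for q
    unfolding c_def by measurable
  have c_int: "integrable P (\<lambda>\<omega>. c (Y \<omega>) q)" for q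
    using c_bound by (intro integrable_const_bound[of _ "dist q q0 powr \<alpha>"]) auto
  have small: "\<exists>d>0. \<forall>p q :: 'q. dist p q < d \<longrightarrow> dist p q powr \<alpha> < e" if "e > 0" for e
  proof (intro exI[of _ "e powr (1 / \<alpha>)"] conjI allI impI)
    fix p q :: 'q assume "dist p q < e powr (1 / \<alpha>)"
    then have "dist p q powr \<alpha> < (e powr (1 / \<alpha>)) powr \<alpha>"
      using \<alpha> by (intro powr_less_mono2) auto
    then show "dist p q powr \<alpha> < e" using that \<alpha> by (simp add: powr_powr)
  qed (use that in simp)

  have f_diff: "\<bar>f \<omega> n p - f \<omega> n q\<bar> \<le> dist p q powr \<alpha>" for \<omega> n p q
  proof (cases "n = 0")
    case False
    have "\<bar>\<Sum>i=1..n. c (Ys i \<omega>) p - c (Ys i \<omega>) q\<bar> \<le> (\<Sum>i=1..n. dist p q powr \<alpha>)"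
      by (intro order_trans[OF sum_abs] sum_mono c_diff)
    moreover have "f \<omega> n p - f \<omega> n q = (\<Sum>i=1..n. c (Ys i \<omega>) p - c (Ys i \<omega>) q) / n"
      by (simp add: f_def sum_subtractf diff_divide_distrib)
    ultimately show ?thesis using False by (simp add: divide_le_eq mult.commute)
  qed (simp add: f_def)
  have equi: "\<exists>d>0. \<forall>n p q. dist p q < d \<longrightarrow> \<bar>f \<omega> n p - f \<omega> n q\<bar> < e" if "e > 0" for e \<omega>
    using small[OF that] f_diff by (meson le_less_trans)
  have F_diff: "\<bar>F p - F q\<bar> \<le> dist p q powr \<alpha>" for p q
  proof -
    have "F p - F q = expectation (\<lambda>\<omega>. c (Y \<omega>) p - c (Y \<omega>) q)"
      unfolding F_def by (simp add: c_int)
    also have "\<bar>\<dots>\<bar> \<le> expectation (\<lambda>\<omega>. \<bar>c (Y \<omega>) p - c (Y \<omega>) q\<bar>)"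
      by (rule integral_abs_bound)
    also have "\<dots> \<le> dist p q powr \<alpha>"
      using c_diff by (intro integral_le_const) (auto intro!: integrable_abs c_int)
    finally show ?thesis .
  qed
  have F_cont: "isCont F q" for q
    unfolding continuous_at_eps_delta dist_real_def using small F_diff by (meson le_less_trans)

  obtain D :: "'q set" where D: "countable D" "\<And>X. open X \<Longrightarrow> X \<noteq> {} \<Longrightarrow> \<exists>d\<in>D. d \<in> X"
    using countable_dense_exists[where 'a = 'q] by blast
  note strong_law = bounded_function_of_iid_strong_law[OF assms(5,6) Y]
  have "AE \<omega> in P. (\<lambda>n. f \<omega> n q) \<longlonglongrightarrow> F q" for q
    using strong_law[OF _ c_meas c_bound, of q] by (simp add: f_def F_def)
  then have "AE \<omega> in P. \<forall>q\<in>D. (\<lambda>n. f \<omega> n q) \<longlonglongrightarrow> F q"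
    using D(1) by (simp add: AE_ball_countable)
  then have outer: "AE \<omega> in P. outer_limit (\<lambda>n. Mn n \<omega>) \<subseteq> M"
  proof eventually_elim
    case (elim \<omega>)
    have "(\<lambda>n. f \<omega> n q) \<longlonglongrightarrow> F q" for q
      by (rule tendsto_from_dense_if_equicontinuous[OF D(2) _ equi F_cont]) (use elim in blast)+
    then show ?case
      unfolding M Mn using equi \<open>\<epsilon> \<longlonglongrightarrow> 0\<close> by (rule outer_limit_eps_argmin_subset_argmin)
  qed

  obtain R where R: "3 / 4 < prob {\<omega> \<in> space P. Y \<omega> \<in> cball q0 R}"
    using exists_cball_prob_gt[OF Y, of "3 / 4" q0] by auto
  define ind :: "'q \<Rightarrow> real" where "ind = indicator (cball q0 R)"
  have [measurable]: "ind \<in> borel_measurable borel"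
    unfolding ind_def by (intro borel_measurable_indicator) simp
  have "expectation (\<lambda>\<omega>. ind (Y \<omega>)) = expectation (indicator {\<omega> \<in> space P. Y \<omega> \<in> cball q0 R})"
    by (intro Bochner_Integration.integral_cong) (auto simp: ind_def indicator_def)
  also have "\<dots> = prob {\<omega> \<in> space P. Y \<omega> \<in> cball q0 R}"
    by (simp add: Int_def conj_commute)
  finally have ind_mean: "3 / 4 < expectation (\<lambda>\<omega>. ind (Y \<omega>))"
    using R by simp
  have "AE \<omega> in P. (\<lambda>n. (\<Sum>i=1..n. ind (Ys i \<omega>)) / n) \<longlonglongrightarrow> expectation (\<lambda>\<omega>. ind (Y \<omega>))"
    by (rule strong_law[where C = 1]) (auto simp: ind_def indicator_def)
  then have mass: "AE \<omega> in P. \<exists>N. \<forall>n\<ge>N. (\<Sum>i=1..n. ind (Ys i \<omega>)) / n \<ge> 3 / 4"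
  proof eventually_elim
    case (elim \<omega>)
    from order_tendstoD(1)[OF elim ind_mean] show ?case
      by (auto simp: eventually_sequentially intro: less_imp_le)
  qed
  obtain N1 where N1: "\<And>n. n \<ge> N1 \<Longrightarrow> \<epsilon> n < 1"
    using order_tendstoD(2)[OF \<open>\<epsilon> \<longlonglongrightarrow> 0\<close>, of 1] by (auto simp: eventually_sequentially)
  have bdd: "AE \<omega> in P. \<exists>N. bounded (\<Union>n\<in>{N..}. Mn n \<omega>)"
    using mass
  proof eventually_elim
    case (elim \<omega>)
    then obtain N where N: "\<And>n. n \<ge> N \<Longrightarrow> (\<Sum>i=1..n. ind (Ys i \<omega>)) / n \<ge> 3 / 4" by blast
    show ?case
    \<comment> \<open>Starting at \<open>1\<close> excludes \<open>n = 0\<close>, where division by \<open>0\<close> makes the empirical objective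
      constant, so that \<open>Mn 0 \<omega>\<close> may be the whole space.\<close>
    proof (rule exI[of _ "max 1 (max N N1)"], rule dist_powr_le_imp_bounded[OF \<open>0 < \<alpha>\<close>])
      fix q assume "q \<in> (\<Union>n\<in>{max 1 (max N N1)..}. Mn n \<omega>)"
      then obtain n where n: "n \<ge> 1" "n \<ge> N" "n \<ge> N1" and q: "q \<in> Mn n \<omega>" by auto
      have "dist q q0 powr \<alpha> \<le> 2 * \<epsilon> n + 3 * R powr \<alpha>"
        using N[OF n(2)] q assms(7)[OF n(1)] n(1) \<alpha>
        by (intro eps_argmin_empirical_bound[of \<alpha> n "\<epsilon> n" q0 R "\<lambda>i. Ys i \<omega>"]) (auto simp: ind_def Mn_def)
      with N1[OF n(3)] show "dist q q0 powr \<alpha> \<le> 2 + 3 * R powr \<alpha>" by linarith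
    qed
  qed

  show ?thesis
  proof (intro conjI impI)
    assume "AE \<omega> in P. \<exists>N0\<ge>1. \<forall>K. K \<subseteq> (\<Union>n\<in>{N0..}. Mn n \<omega>) \<and> closed K \<and> bounded K \<longrightarrow> compact K"
    with outer bdd show "AE \<omega> in P. (\<lambda>n. one_sided_hausdorff (Mn n \<omega>) M) \<longlonglongrightarrow> 0"
    proof eventually_elim
      case (elim \<omega>)
      then obtain N N0 where N: "bounded (\<Union>n\<in>{N..}. Mn n \<omega>)"
        and N0: "\<And>K. K \<subseteq> (\<Union>n\<in>{N0..}. Mn n \<omega>) \<Longrightarrow> closed K \<Longrightarrow> bounded K \<Longrightarrow> compact K"
        by blast
      have sub: "(\<Union>n\<in>{max N N0..}. Mn n \<omega>) \<subseteq> (\<Union>n\<in>{N..}. Mn n \<omega>)"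
        "(\<Union>n\<in>{max N N0..}. Mn n \<omega>) \<subseteq> (\<Union>n\<in>{N0..}. Mn n \<omega>)"
        by auto
      show ?case
      proof (rule one_sided_hausdorff_tendsto_0[OF elim(1)])
        show "bounded (\<Union>n\<in>{max N N0..}. Mn n \<omega>)"
          using N sub(1) by (rule bounded_subset)
        show "compact K" if "K \<subseteq> (\<Union>n\<in>{max N N0..}. Mn n \<omega>)" "closed K" "bounded K" for K
          using N0 order_trans[OF that(1) sub(2)] that by blast
      qed
    qed
  qed (rule outer)
qed

end
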